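(* Let $(\mathfrak m,V,\omega,B_\mu)$ be a special symplectic representation over $k$ and let $A\in V$. (i) $Q(A)\neq 0$ if and only if $V=\mathfrak m\cdot A\oplus\langle A\rangle$. In this case $\mathrm{Ker}\,d\mu_A=\langle\Psi(A)\rangle$ and $\mathrm{Ker}\,dQ_A=\mathfrak m\cdot A$. (ii) Suppose $\dim V>2$ and $A\neq 0$. Then $\mathfrak m\cdot A$ is Lagrangian if and only if $\mu(A)=0$.
   Context: $k$ is a field of characteristic not $2$ or $3$. $\langle\cdot\rangle$ denotes linear span over $k$. A special symplectic representation (SSR) $(\mathfrak m,V,\omega,B_\mu)$ over $k$ is a faithful representation of a Lie algebra $\mathfrak m$ over $k$ on a symplectic vector space $(V,\omega)$ ($\omega$ a nondegenerate alternating bilinear form), together with an $\mathfrak m$-equivariant symmetric bilinear map $B_\mu:V\times V\to\mathfrak m$ (equivariance: $[m,B_\mu(A,B)]=B_\mu(m\cdot A,B)+B_\mu(A,m\cdot B)$), such that for all $m\in\mathfrak m$ and $A,B,C\in V$: $$\omega(m\cdot A,B)+\omega(A,m\cdot B)=0,$$ $$2B_\mu(A,B)\cdot C-2B_\mu(A,C)\cdot B=2\omega(B,C)A-\omega(A,B)C+\omega(A,C)B.$$ Covariants: $\mu(A)=B_\mu(A,A)\in\mathfrak m$, $\Psi(A)=\mu(A)\cdot A\in V$, $Q(A)=\frac32\,\omega(A,\Psi(A))\in k$. Notation: $\mathfrak m\cdot A=\{m\cdot A:m\in\mathfrak m\}$. The derivatives are the linear maps $d\mu_A:V\to\mathfrak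 m$, $d\mu_A(B)=2B_\mu(A,B)$, and $dQ_A:V\to k$, $dQ_A(B)=4B_Q(B,A,A,A)$, where $B_Q$ is the symmetric quadrilinear polar form of $Q$ (so $B_Q(A,A,A,A)=Q(A)$). A subspace is Lagrangian if it equals its own $\omega$-orthogonal.
   Formalization: The formal statement assumes V ≠ 0; for V = 0, 𝔪 = 0, A = 0 one has Q(A) = 0 although V = 𝔪·A ⊕ ⟨A⟩, so the first equivalence of (i) fails there. *)

theory Defs
  imports Complex_Main
begin

text \<open>
  Vector spaces over a field of type \<open>'k\<close> are whole types, with an explicit scalar
  multiplication satisfying the library locale \<open>vector_space\<close>; they may be
  infinite-dimensional. The field itself is the vector space with scalar multiplication \<open>(*)\<close>.
\<close>

locale bilinear_map =
  fixes s1 :: "'k::field \<Rightarrow> 'a::ab_group_add \<Rightarrow> 'a"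
    and s2 :: "'k \<Rightarrow> 'b::ab_group_add \<Rightarrow> 'b"
    and s3 :: "'k \<Rightarrow> 'c::ab_group_add \<Rightarrow> 'c"
    and f :: "'a \<Rightarrow> 'b \<Rightarrow> 'c"
  assumes linear_left: "Vector_Spaces.linear s1 s3 (\<lambda>x. f x y)"
    and linear_right: "Vector_Spaces.linear s2 s3 (\<lambda>y. f x y)"

locale lie_algebra = vector_space sM
  for sM :: "'k::field \<Rightarrow> 'm::ab_group_add \<Rightarrow> 'm" +
  fixes bracket :: "'m \<Rightarrow> 'm \<Rightarrow> 'm"
  assumes bracket_bilinear: "bilinear_map sM sM sM bracket"
    and bracket_self: "bracket x x = 0"
    and jacobi: "bracket x (bracket y z) + bracket y (bracket z x) + bracket z (bracket x y) = 0"

locale lie_representation = M: lie_algebra sM bracket + V: vector_space sV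
  for sM :: "'k::field \<Rightarrow> 'm::ab_group_add \<Rightarrow> 'm"
    and bracket :: "'m \<Rightarrow> 'm \<Rightarrow> 'm"
    and sV :: "'k \<Rightarrow> 'v::ab_group_add \<Rightarrow> 'v" +
  fixes act :: "'m \<Rightarrow> 'v \<Rightarrow> 'v"
  assumes act_bilinear: "bilinear_map sM sV sV act"
    and act_bracket: "act (bracket x y) v = act x (act y v) - act y (act x v)"

locale symplectic_space = vector_space sV
  for sV :: "'k::field \<Rightarrow> 'v::ab_group_add \<Rightarrow> 'v" +
  fixes \<omega> :: "'v \<Rightarrow> 'v \<Rightarrow> 'k"
  assumes form_bilinear: "bilinear_map sV sV (*) \<omega>"
    and form_alternating: "\<omega> v v = 0"
    and form_nondegenerate: "(\<And>w. \<omega> v w = 0) \<Longrightarrow> v = 0"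

locale special_symplectic_representation =
  lie_representation sM bracket sV act + symplectic_space sV \<omega>
  for sM :: "'k::field \<Rightarrow> 'm::ab_group_add \<Rightarrow> 'm"
    and bracket :: "'m \<Rightarrow> 'm \<Rightarrow> 'm"
    and sV :: "'k \<Rightarrow> 'v::ab_group_add \<Rightarrow> 'v"
    and act :: "'m \<Rightarrow> 'v \<Rightarrow> 'v"
    and \<omega> :: "'v \<Rightarrow> 'v \<Rightarrow> 'k" +
  fixes B\<^sub>\<mu> :: "'v \<Rightarrow> 'v \<Rightarrow> 'm"
  assumes faithful: "inj act"
    and Bmu_bilinear: "bilinear_map sV sV sM B\<^sub>\<mu>"
    and Bmu_symmetric: "B\<^sub>\<mu> a b = B\<^sub>\<mu> b a"
    and Bmu_equivariant: "bracket m (B\<^sub>\<mu> a b) = B\<^sub>\<mu> (act m a) b + B\<^sub>\<mu> a (act m b)"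
    and form_invariant: "\<omega> (act m a) b + \<omega> a (act m b) = 0"
    and Bmu_commutation:
      "sV 2 (act (B\<^sub>\<mu> a b) c) - sV 2 (act (B\<^sub>\<mu> a c) b) =
       sV (2 * \<omega> b c) a - sV (\<omega> a b) c + sV (\<omega> a c) b"

definition mu :: "('v \<Rightarrow> 'v \<Rightarrow> 'm) \<Rightarrow> 'v \<Rightarrow> 'm"
  where "mu B\<^sub>\<mu> A = B\<^sub>\<mu> A A"

definition Psi :: "('m \<Rightarrow> 'v \<Rightarrow> 'v) \<Rightarrow> ('v \<Rightarrow> 'v \<Rightarrow> 'm) \<Rightarrow> 'v \<Rightarrow> 'v"
  where "Psi act B\<^sub>\<mu> A = act (mu B\<^sub>\<mu> A) A"

definition Q :: "('m \<Rightarrow> 'v \<Rightarrow> 'v) \<Rightarrow> ('v \<Rightarrow> 'v \<Rightarrow> 'k::field) \<Rightarrow> ('v \<Rightarrow> 'v \<Rightarrow> 'm) \<Rightarrow> 'v \<Rightarrow> 'k"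
  where "Q act \<omega> B\<^sub>\<mu> A = 3 / 2 * \<omega> A (Psi act B\<^sub>\<mu> A)"

definition orbit_space :: "('m \<Rightarrow> 'v \<Rightarrow> 'v) \<Rightarrow> 'v \<Rightarrow> 'v set"
  where "orbit_space act A = {act m A | m. True}"

text \<open>Adjacent transpositions generate all permutations of the four arguments.\<close>

definition symmetric_quadrilinear ::
    "('k::field \<Rightarrow> 'v::ab_group_add \<Rightarrow> 'v) \<Rightarrow> ('v \<Rightarrow> 'v \<Rightarrow> 'v \<Rightarrow> 'v \<Rightarrow> 'k) \<Rightarrow> bool"
  where "symmetric_quadrilinear sV F \<longleftrightarrow>
    (\<forall>b c d. Vector_Spaces.linear sV (*) (\<lambda>a. F a b c d)) \<and>
    (\<forall>a c d. Vector_Spaces.linear sV (*) (\<lambda>b. F a b c d)) \<and>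
    (\<forall>a b d. Vector_Spaces.linear sV (*) (\<lambda>c. F a b c d)) \<and>
    (\<forall>a b c. Vector_Spaces.linear sV (*) (\<lambda>d. F a b c d)) \<and>
    (\<forall>a b c d. F a b c d = F b a c d \<and> F a b c d = F a c b d \<and> F a b c d = F a b d c)"

text \<open>
  The polar form of a quartic function \<open>q\<close>. In characteristic different from 2 and 3 there is at
  most one such form, and \<open>Q\<close> has one.
\<close>

definition quartic_polar_form ::
    "('k::field \<Rightarrow> 'v::ab_group_add \<Rightarrow> 'v) \<Rightarrow> ('v \<Rightarrow> 'k) \<Rightarrow> 'v \<Rightarrow> 'v \<Rightarrow> 'v \<Rightarrow> 'v \<Rightarrow> 'k"
  where "quartic_polar_form sV q =
    (THE F. symmetric_quadrilinear sV F \<and> (\<forall>a. F a a a a = q a))"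

definition dmu ::
    "('k::field \<Rightarrow> 'm::ab_group_add \<Rightarrow> 'm) \<Rightarrow> ('v \<Rightarrow> 'v \<Rightarrow> 'm) \<Rightarrow> 'v \<Rightarrow> 'v \<Rightarrow> 'm"
  where "dmu sM B\<^sub>\<mu> A B = sM 2 (B\<^sub>\<mu> A B)"

definition dQ ::
    "('k::field \<Rightarrow> 'v::ab_group_add \<Rightarrow> 'v) \<Rightarrow> ('m \<Rightarrow> 'v \<Rightarrow> 'v) \<Rightarrow> ('v \<Rightarrow> 'v \<Rightarrow> 'k) \<Rightarrow>
      ('v \<Rightarrow> 'v \<Rightarrow> 'm) \<Rightarrow> 'v \<Rightarrow> 'v \<Rightarrow> 'k"
  where "dQ sV act \<omega> B\<^sub>\<mu> A B = 4 * quartic_polar_form sV (Q act \<omega> B\<^sub>\<mu>) B A A A"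

definition kernel :: "('v \<Rightarrow> 'w::zero) \<Rightarrow> 'v set"
  where "kernel f = {v. f v = 0}"

definition is_direct_sum ::
    "('k::field \<Rightarrow> 'v::ab_group_add \<Rightarrow> 'v) \<Rightarrow> 'v set \<Rightarrow> 'v set \<Rightarrow> bool"
  where "is_direct_sum sV U W \<longleftrightarrow>
    module.subspace sV U \<and> module.subspace sV W \<and>
    U \<inter> W = {0} \<and> (\<forall>v. \<exists>u\<in>U. \<exists>w\<in>W. v = u + w)"

definition orthogonal_space :: "('v \<Rightarrow> 'v \<Rightarrow> 'k::zero) \<Rightarrow> 'v set \<Rightarrow> 'v set"
  where "orthogonal_space \<omega> U = {v. \<forall>u\<in>U. \<omega> u v = 0}"

definition lagrangian ::
    "('k::field \<Rightarrow> 'v::ab_group_add \<Rightarrow> 'v) \<Rightarrow> ('v \<Rightarrow> 'v \<Rightarrow> 'k) \<Rightarrow> 'v set \<Rightarrow> bool"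
  where "lagrangian sV \<omega> L \<longleftrightarrow> module.subspace sV L \<and> L = orthogonal_space \<omega> L"

text \<open>
  The library's \<open>dim\<close> is 0 on spaces without a finite basis, so \<open>dim V > n\<close> is expressed by a
  basis that is infinite or has more than \<open>n\<close> elements.
\<close>

definition dim_gt :: "('k::field \<Rightarrow> 'v::ab_group_add \<Rightarrow> 'v) \<Rightarrow> nat \<Rightarrow> bool"
  where "dim_gt sV n \<longleftrightarrow>
    (\<exists>b. \<not> module.dependent sV b \<and> module.span sV b = UNIV \<and> (finite b \<longrightarrow> card b > n))"

end

theory Submission
  imports Defs
begin

text \<open>
  Write \<open>t = \<omega> A (\<Psi> A)\<close>, so that \<open>Q A\<close> is \<open>3/2 t\<close>, and \<open>\<mm> A\<close> for the space of all \<open>m A\<close>. Everything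
  follows from two special cases of the commutation identity.

  Taking \<open>A, A, C\<close> as its arguments gives \<open>\<mu>(A) C = B(A, C) A + 3/2 \<omega>(A, C) A\<close> (\<open>mu_act\<close>), so
  \<open>\<mu>(A)\<close> maps every vector into \<open>\<mm> A + \<langle>A\<rangle>\<close>. Equivariance applied to \<open>[\<mu>(A), \<mu>(A)] = 0\<close> gives
  \<open>B(A, \<Psi>(A)) = 0\<close>; then the arguments \<open>A, C, \<Psi>(A)\<close> give
  \<open>t/2 C = B(A, C) \<Psi>(A) - \<omega>(C, \<Psi>(A)) A + \<omega>(A, C)/2 \<Psi>(A)\<close> (\<open>scale_by_form_Psi\<close>). Since
  \<open>\<Psi>(A) = \<mu>(A) A\<close>, the right-hand side lies in \<open>\<mm> A + \<langle>A\<rangle>\<close>, so for \<open>t \<noteq> 0\<close> this sum is all of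
  \<open>V\<close>. It is direct because \<open>\<mm> A\<close> is orthogonal to \<open>\<Psi>(A)\<close> (\<open>form_orbit_Psi\<close>, the invariance of
  the quartic) whereas \<open>A\<close> is not. The same formula shows that \<open>B(A, C) = 0\<close> forces
  \<open>C \<in> \<langle>A, \<Psi>(A)\<rangle>\<close>, and then \<open>C \<in> \<langle>\<Psi>(A)\<rangle>\<close>. Polarising \<open>Q\<close> gives \<open>dQ\<^sub>A = 6 \<omega>(\<cdot>, \<Psi>(A))\<close>, which
  vanishes on \<open>\<mm> A\<close> but not at \<open>A\<close>. Conversely, if \<open>V\<close> is the direct sum and \<open>t = 0\<close>, then
  \<open>\<Psi>(A)\<close> is orthogonal to everything, so it is \<open>0\<close>; in that case \<open>\<omega>(A, m A) A\<close> lies in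
  \<open>\<mm> A \<inter> \<langle>A\<rangle>\<close> for every \<open>m\<close>, and \<open>A\<close> itself is orthogonal to everything.

  For the Lagrangian criterion the tool is the symmetry \<open>\<omega>(B(a, b) c, d) = \<omega>(B(c, d) a, b)\<close>
  (\<open>Bmu_pair_symmetric\<close>): it says that \<open>C\<close> is orthogonal to \<open>B(v, w) A\<close> for all \<open>v, w\<close> exactly
  when \<open>B(A, C)\<close> acts by zero. If \<open>\<mm> A\<close> is Lagrangian, it follows that \<open>B(A, \<cdot>)\<close> vanishes on
  \<open>\<mm> A\<close>, so that it suffices to see that \<open>A \<in> \<mm> A\<close>. If \<open>t \<noteq> 0\<close>, then
  \<open>V = \<langle>A, \<Psi>(A)\<rangle>\<close> would have dimension at most 2; and if \<open>t = 0\<close>, the formulas above make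
  \<open>A\<close> orthogonal to \<open>\<mm> A\<close>. If conversely \<open>\<mu>(A) = 0\<close>, then \<open>\<mm> A\<close> is isotropic by
  equivariance, and any \<open>C\<close> orthogonal to it satisfies \<open>B(A, C) = 0\<close>, from which the commutation
  identity produces \<open>C\<close> as an element of \<open>\<mm> A\<close>.
\<close>

section \<open>Quartic polar forms\<close>

lemma two_three_nonzero:
  assumes "CHAR('k::field) \<noteq> 2" "CHAR('k) \<noteq> 3"
  shows "(2::'k) \<noteq> 0" "(3::'k) \<noteq> 0"
proof -
  have "CHAR('k) \<noteq> 1"
    by simp
  moreover have "n = 1 \<or> n = 2" if "n dvd 2" for n :: nat
    using that dvd_imp_le[OF that] by (cases "n = 0") auto
  moreover have "n = 1 \<or> n = 3" if "n dvd 3" for n :: nat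
  proof -
    have "n \<noteq> 2"
      using that by auto
    then show ?thesis
      using that dvd_imp_le[OF that] by (cases "n = 0") auto
  qed
  ultimately have "\<not> CHAR('k) dvd 2" "\<not> CHAR('k) dvd 3"
    using assms by blast+
  then show "(2::'k) \<noteq> 0" "(3::'k) \<noteq> 0"
    using of_nat_eq_0_iff_char_dvd[of 2, where 'a = 'k]
      of_nat_eq_0_iff_char_dvd[of 3, where 'a = 'k]
    by simp_all
qed

text \<open>
  Polarisation one pair of arguments at a time: adding the diagonal values at \<open>x + y\<close> and \<open>x - y\<close>
  isolates \<open>12 F(x, x, y, y)\<close>, and polarising in \<open>y\<close> and then in \<open>x\<close> reaches all
  arguments, so that only 2 and 3 have to be invertible.
\<close>

lemma symmetric_quadrilinear_eq_0:
  fixes F :: "'v::ab_group_add \<Rightarrow> 'v \<Rightarrow> 'v \<Rightarrow> 'v \<Rightarrow> 'k::field"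
  assumes ne: "(2::'k) \<noteq> 0" "(3::'k) \<noteq> 0"
    and F: "symmetric_quadrilinear sV F"
    and diag: "\<And>a. F a a a a = 0"
  shows "F a b c d = 0"
proof -
  have add: "F (x + y) b c d = F x b c d + F y b c d" for x y b c d
    using F unfolding symmetric_quadrilinear_def Vector_Spaces.linear_iff by simp
  have swap1: "F a b c d = F b a c d" and swap2: "F a b c d = F a c b d"
    and swap3: "F a b c d = F a b d c" for a b c d
    using F unfolding symmetric_quadrilinear_def by blast+
  have add2: "F b (x + y) c d = F b x c d + F b y c d" for x y b c d
    using add swap1 by metis
  have add3: "F b c (x + y) d = F b c x d + F b c y d" for x y b c d
    using add2 swap2 by metis
  have add4: "F b c d (x + y) = F b c d x + F b c d y" for x y b c d
    using add3 swap3 by metis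
  have neg: "F (- x) b c d = - F x b c d" for x b c d
    using add[of x "- x" b c d] add[of 0 0 b c d] by (simp add: eq_neg_iff_add_eq_0 add.commute)
  have neg2: "F b (- x) c d = - F b x c d" for x b c d
    using neg swap1 by metis
  have neg3: "F b c (- x) d = - F b c x d" for x b c d
    using neg2 swap2 by metis
  have neg4: "F b c d (- x) = - F b c d x" for x b c d
    using neg3 swap3 by metis
  note adds = add add2 add3 add4 neg neg2 neg3 neg4
  have expand: "F (x + y) (x + y) (x + y) (x + y) =
      4 * F x x x y + 6 * F x x y y + 4 * F x y y y" for x y
  proof -
    have "F x x y x = F x x x y" "F x y x x = F x x x y" "F y x x x = F x x x y"
      "F x y x y = F x x y y" "F x y y x = F x x y y" "F y x x y = F x x y y"
      "F y x y x = F x x y y" "F y y x x = F x x y y"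
      "F y x y y = F x y y y" "F y y x y = F x y y y" "F y y y x = F x y y y"
      by (metis swap1 swap2 swap3)+
    then show ?thesis
      by (simp only: adds) (simp add: diag)
  qed
  have twos: "F x x y y = 0" for x y
  proof -
    have "4 * F x x x y + 6 * F x x y y + 4 * F x y y y = 0"
      using expand[of x y] by (simp add: diag)
    moreover have "- 4 * F x x x y + 6 * F x x y y - 4 * F x y y y = 0"
      using expand[of x "- y"] by (simp add: diag neg2 neg3 neg4)
    ultimately have "(4 * F x x x y + 6 * F x x y y + 4 * F x y y y) +
        (- 4 * F x x x y + 6 * F x x y y - 4 * F x y y y) = 0"
      by (simp only: add_0_right)
    then have "12 * F x x y y = 0"
      by (simp add: algebra_simps)
    moreover have "(12::'k) = 2 * 2 * 3"
      by simp
    then have "(12::'k) \<noteq> 0"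
      using ne by (metis mult_eq_0_iff)
    ultimately show ?thesis
      by simp
  qed
  have "2 * F x x y z = 0" for x y z
    using twos[of x "y + z"] swap3[of x x z y] unfolding adds by (simp add: twos)
  then have pair: "F x x y z = 0" for x y z
    using ne by simp
  have "2 * F a b c d = 0"
    using pair[of "a + b" c d] swap1[of b a c d] unfolding adds by (simp add: pair)
  then show ?thesis
    using ne by simp
qed

lemma quartic_polar_form_eqI:
  fixes F :: "'v::ab_group_add \<Rightarrow> 'v \<Rightarrow> 'v \<Rightarrow> 'v \<Rightarrow> 'k::field"
  assumes ne: "(2::'k) \<noteq> 0" "(3::'k) \<noteq> 0"
    and F: "symmetric_quadrilinear sV F" "\<And>a. F a a a a = q a"
  shows "quartic_polar_form sV q = F"
  unfolding quartic_polar_form_def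
proof (rule the_equality)
  show "symmetric_quadrilinear sV F \<and> (\<forall>a. F a a a a = q a)"
    using F by blast
next
  fix G
  assume G: "symmetric_quadrilinear sV G \<and> (\<forall>a. G a a a a = q a)"
  have "symmetric_quadrilinear sV (\<lambda>a b c d. G a b c d - F a b c d)"
    using G F(1) unfolding symmetric_quadrilinear_def Vector_Spaces.linear_iff
    by (auto simp: algebra_simps)
  then have "G a b c d - F a b c d = 0" for a b c d
    by (rule symmetric_quadrilinear_eq_0[OF ne]) (use F G in auto)
  then show "G = F"
    by (intro ext) auto
qed

section \<open>Consequences of the commutation identity\<close>

text \<open>
  The characteristic enters only through the cancellation of factors 2 and 3.
\<close>

locale special_symplectic_representation_23 =
  special_symplectic_representation sM bracket sV act \<omega> B\<^sub>\<mu>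
  for sM :: "'k::field \<Rightarrow> 'm::ab_group_add \<Rightarrow> 'm"
    and bracket :: "'m \<Rightarrow> 'm \<Rightarrow> 'm"
    and sV :: "'k \<Rightarrow> 'v::ab_group_add \<Rightarrow> 'v"
    and act :: "'m \<Rightarrow> 'v \<Rightarrow> 'v"
    and \<omega> :: "'v \<Rightarrow> 'v \<Rightarrow> 'k"
    and B\<^sub>\<mu> :: "'v \<Rightarrow> 'v \<Rightarrow> 'm" +
  assumes two: "(2::'k) \<noteq> 0" and three: "(3::'k) \<noteq> 0"
begin

abbreviation \<Psi> :: "'v \<Rightarrow> 'v" where "\<Psi> \<equiv> Psi act B\<^sub>\<mu>"

abbreviation \<mu> :: "'v \<Rightarrow> 'm" where "\<mu> \<equiv> mu B\<^sub>\<mu>"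

abbreviation orbit :: "'v \<Rightarrow> 'v set" where "orbit \<equiv> orbit_space act"

lemma bilinear_rules:
  "act (x + y) v = act x v + act y v" "act (sM c x) v = sV c (act x v)"
  "act x (v + w) = act x v + act x w" "act x (sV c v) = sV c (act x v)"
  "\<omega> (u + v) w = \<omega> u w + \<omega> v w" "\<omega> (sV c v) w = c * \<omega> v w"
  "\<omega> w (u + v) = \<omega> w u + \<omega> w v" "\<omega> w (sV c v) = c * \<omega> w v"
  "B\<^sub>\<mu> (u + v) w = B\<^sub>\<mu> u w + B\<^sub>\<mu> v w" "B\<^sub>\<mu> (sV c v) w = sM c (B\<^sub>\<mu> v w)"
  "B\<^sub>\<mu> w (u + v) = B\<^sub>\<mu> w u + B\<^sub>\<mu> w v" "B\<^sub>\<mu> w (sV c v) = sM c (B\<^sub>\<mu> w v)"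
  using act_bilinear form_bilinear Bmu_bilinear
  unfolding bilinear_map_def Vector_Spaces.linear_iff by simp_all

lemma zero_rules:
  "act 0 v = 0" "act x 0 = 0" "\<omega> 0 v = 0" "\<omega> v 0 = 0" "B\<^sub>\<mu> 0 v = 0" "B\<^sub>\<mu> v 0 = 0"
  using bilinear_rules(2)[of 0 0 v] bilinear_rules(4)[of x 0 0] bilinear_rules(6)[of 0 0 v]
    bilinear_rules(8)[of v 0 0] bilinear_rules(10)[of 0 0 v] bilinear_rules(12)[of v 0 0]
  by simp_all

lemma neg_rules:
  "act (- x) v = - act x v" "act x (- v) = - act x v" "\<omega> (- v) w = - \<omega> v w" "\<omega> w (- v) = - \<omega> w v"
  using bilinear_rules(1)[of x "- x" v] bilinear_rules(3)[of x v "- v"]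
    bilinear_rules(5)[of v "- v" w] bilinear_rules(7)[of w v "- v"]
  by (simp_all add: zero_rules eq_neg_iff_add_eq_0 add.commute)

lemma diff_rules:
  "act (x - y) v = act x v - act y v" "act x (v - w) = act x v - act x w"
  "\<omega> (u - v) w = \<omega> u w - \<omega> v w" "\<omega> w (u - v) = \<omega> w u - \<omega> w v"
  by (simp_all only: diff_conv_add_uminus bilinear_rules neg_rules)

lemmas multilinear = bilinear_rules zero_rules neg_rules diff_rules

lemma form_skew: "\<omega> b a = - \<omega> a b"
proof -
  have "\<omega> b a + \<omega> a b = 0"
    using form_alternating[of "a + b"] unfolding bilinear_rules
    by (simp add: form_alternating add.commute)
  then show ?thesis
    by (simp only: eq_neg_iff_add_eq_0)
qed

lemma act_form: "\<omega> (act m a) b = - \<omega> a (act m b)"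
  using form_invariant[of m a b] by (simp add: eq_neg_iff_add_eq_0)

lemma eq_0_if_orthogonal: "(\<And>w. \<omega> w v = 0) \<Longrightarrow> v = 0"
  using form_nondegenerate[of v] form_skew[of v] by auto

lemma eq_0_if_acts_trivially:
  assumes "\<And>v. act m v = 0"
  shows "m = 0"
proof -
  have "act m = act 0"
    using assms by (auto simp: multilinear)
  then show ?thesis
    using faithful by (simp add: inj_eq)
qed

lemma double_eq_0: "m + m = 0 \<Longrightarrow> m = 0" for m :: 'm
  using two M.scale_left_distrib[of 1 1 m] by simp

lemma orbitI [intro]: "act m A \<in> orbit A"
  by (auto simp: orbit_space_def)

lemma orbitE [elim]:
  assumes "v \<in> orbit A"
  obtains m where "v = act m A"
  using assms by (auto simp: orbit_space_def)

lemma subspace_orbit: "V.subspace (orbit A)"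
  unfolding V.subspace_def
proof (intro conjI ballI allI)
  show "0 \<in> orbit A"
    using orbitI[of 0 A] by (simp add: multilinear)
  show "x + y \<in> orbit A" if "x \<in> orbit A" "y \<in> orbit A" for x y
    using that by (metis bilinear_rules(1) orbitE orbitI)
  show "sV c x \<in> orbit A" if "x \<in> orbit A" for x c
    using that by (metis bilinear_rules(2) orbitE orbitI)
qed

lemma Bmu_act_swap:
  "act (B\<^sub>\<mu> a b) c =
    act (B\<^sub>\<mu> a c) b + sV (\<omega> b c) a - sV (\<omega> a b / 2) c + sV (\<omega> a c / 2) b"
proof -
  have "sV (1/2) (sV 2 (act (B\<^sub>\<mu> a b) c) - sV 2 (act (B\<^sub>\<mu> a c) b)) =
      sV (1/2) (sV (2 * \<omega> b c) a - sV (\<omega> a b) c + sV (\<omega> a c) b)"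
    by (simp only: Bmu_commutation)
  then have "act (B\<^sub>\<mu> a b) c - act (B\<^sub>\<mu> a c) b =
      sV (\<omega> b c) a - sV (\<omega> a b / 2) c + sV (\<omega> a c / 2) b"
    using two by (simp add: V.scale_right_distrib V.scale_right_diff_distrib)
  then show ?thesis
    by (simp add: algebra_simps)
qed

text \<open>
  The 4-linear form \<open>\<omega>(B(a, b) c, d)\<close> is symmetric in \<open>a, b\<close> and in \<open>c, d\<close>. Two exchanges by the
  commutation identity, first of \<open>b\<close> with \<open>c\<close> and then of \<open>a\<close> with \<open>d\<close>, interchange the pairs; the
  correction terms, all products of two values of \<open>\<omega>\<close>, cancel.
\<close>

lemma Bmu_pair_symmetric: "\<omega> (act (B\<^sub>\<mu> a b) c) d = \<omega> (act (B\<^sub>\<mu> c d) a) b"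
proof -
  have "\<omega> (act (B\<^sub>\<mu> a b) c) d =
      \<omega> (act (B\<^sub>\<mu> a c) b) d + \<omega> b c * \<omega> a d - \<omega> a b / 2 * \<omega> c d + \<omega> a c / 2 * \<omega> b d"
    by (subst Bmu_act_swap) (simp add: multilinear)
  moreover have "\<omega> (act (B\<^sub>\<mu> a c) b) d = \<omega> (act (B\<^sub>\<mu> c a) d) b"
    by (simp add: act_form[of _ b] form_skew[of _ b] Bmu_symmetric[of a c])
  moreover have "\<omega> (act (B\<^sub>\<mu> c a) d) b =
      \<omega> (act (B\<^sub>\<mu> c d) a) b + \<omega> a d * \<omega> c b - \<omega> c a / 2 * \<omega> d b + \<omega> c d / 2 * \<omega> a b"
    by (subst Bmu_act_swap) (simp add: multilinear)
  ultimately show ?thesis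
    by (simp add: form_skew[of b c] form_skew[of a c] form_skew[of b d])
qed

lemma mu_act: "act (\<mu> A) C = act (B\<^sub>\<mu> A C) A + sV (3 / 2 * \<omega> A C) A"
proof -
  have "\<omega> A C + \<omega> A C / 2 = 3 / 2 * \<omega> A C"
    using two by (simp add: field_simps)
  then have "sV (3 / 2 * \<omega> A C) A = sV (\<omega> A C) A + sV (\<omega> A C / 2) A"
    by (metis V.scale_left_distrib)
  then show ?thesis
    using Bmu_act_swap[of A A C] by (simp add: mu_def form_alternating add.assoc)
qed

text \<open>
  By equivariance, \<open>0 = [\<mu>(A), \<mu>(A)]\<close> is twice \<open>B(A, \<mu>(A) A)\<close>.
\<close>

lemma Bmu_Psi: "B\<^sub>\<mu> A (\<Psi> A) = 0"
  using Bmu_equivariant[of "\<mu> A" A A] M.bracket_self Bmu_symmetric[of A "\<Psi> A"]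
  by (metis Psi_def double_eq_0 mu_def)

lemma bracket_mu: "bracket m (\<mu> A) = B\<^sub>\<mu> A (act m A) + B\<^sub>\<mu> A (act m A)"
  using Bmu_equivariant[of m A A] Bmu_symmetric[of "act m A"] by (simp add: mu_def)

lemma act_Psi: "act m (\<Psi> A) = act (\<mu> A) (act m A) + act (B\<^sub>\<mu> A (act m A)) A + act (B\<^sub>\<mu> A (act m A)) A"
  using act_bracket[of m "\<mu> A" A]
  by (simp add: Psi_def bracket_mu multilinear algebra_simps)

text \<open>
  Infinitesimal invariance of the quartic \<open>A \<mapsto> \<omega>(A, \<Psi>(A))\<close>: differentiating it along \<open>m A\<close>
  gives 0 by the invariance of \<open>\<omega>\<close>, and also four times \<open>\<omega>(m A, \<Psi>(A))\<close>, one for each argument.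
\<close>

lemma form_orbit_Psi: "\<omega> (act m A) (\<Psi> A) = 0"
proof -
  let ?t = "\<omega> (act m A) (\<Psi> A)"
  have mu: "\<omega> A (act (\<mu> A) (act m A)) = ?t"
    using act_form[of "\<mu> A" A "act m A"] form_skew[of "\<Psi> A"] by (simp add: Psi_def)
  have Bmu: "\<omega> A (act (B\<^sub>\<mu> A (act m A)) A) = ?t"
    using mu by (simp add: mu_act multilinear form_alternating)
  have "\<omega> A (act m (\<Psi> A)) = ?t + ?t + ?t"
    by (simp only: act_Psi bilinear_rules mu Bmu)
  then have "?t = - (?t + ?t + ?t)"
    by (simp only: act_form)
  then have "(2 * 2) * ?t = 0"
    by (simp add: eq_neg_iff_add_eq_0)
  then show ?thesis
    using two by (metis mult_eq_0_iff)
qed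

text \<open>
  This recovers any vector \<open>C\<close> from \<open>B(A, C)\<close> and its pairings with \<open>A\<close> and \<open>\<Psi>(A)\<close> once
  \<open>\<omega>(A, \<Psi>(A))\<close> is invertible.
\<close>

lemma scale_by_form_Psi:
  "sV (\<omega> A (\<Psi> A) / 2) C = act (B\<^sub>\<mu> A C) (\<Psi> A) - sV (\<omega> C (\<Psi> A)) A + sV (\<omega> A C / 2) (\<Psi> A)"
  using Bmu_act_swap[of A C "\<Psi> A"] by (simp add: Bmu_Psi multilinear algebra_simps)

lemma Q_nonzero_iff: "Q act \<omega> B\<^sub>\<mu> A \<noteq> 0 \<longleftrightarrow> \<omega> A (\<Psi> A) \<noteq> 0"
  using two three by (simp add: Q_def)

section \<open>The nondegenerate case\<close>

text \<open>
  In \<open>scale_by_form_Psi\<close> only \<open>B(A, C) \<Psi>(A)\<close> is not evidently in \<open>\<mm> A + \<langle>A\<rangle>\<close>. Moving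
  \<open>n = B(A, C)\<close> past \<open>\<mu>(A)\<close> in \<open>n \<mu>(A) A\<close> leaves an element of the orbit space and
  \<open>\<mu>(A) n A\<close>, which \<open>mu_act\<close> puts there up to a multiple of \<open>A\<close>.
\<close>

lemma in_orbit_plus_line:
  assumes "\<omega> A (\<Psi> A) \<noteq> 0"
  shows "\<exists>m c. C = act m A + sV c A"
proof -
  define r where "r = 2 / \<omega> A (\<Psi> A)"
  define n where "n = B\<^sub>\<mu> A C"
  have "C = sV r (sV (\<omega> A (\<Psi> A) / 2) C)"
    using assms two by (simp add: r_def)
  also have "sV (\<omega> A (\<Psi> A) / 2) C =
      act n (\<Psi> A) - sV (\<omega> C (\<Psi> A)) A + sV (\<omega> A C / 2) (\<Psi> A)"
    by (simp add: scale_by_form_Psi n_def)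
  also have "act n (\<Psi> A) =
     act (B\<^sub>\<mu> A (act n A) + B\<^sub>\<mu> A (act n A) + B\<^sub>\<mu> A (act n A)) A + sV (3 / 2 * \<omega> A (act n A)) A"
    by (simp add: act_Psi mu_act multilinear algebra_simps)
  also have "sV (\<omega> A C / 2) (\<Psi> A) = act (sM (\<omega> A C / 2) (\<mu> A)) A"
    by (simp add: multilinear Psi_def)
  finally have "C = act (sM r (B\<^sub>\<mu> A (act n A) + B\<^sub>\<mu> A (act n A) + B\<^sub>\<mu> A (act n A) + sM (\<omega> A C / 2) (\<mu> A))) A
      + sV (r * (3 / 2 * \<omega> A (act n A) - \<omega> C (\<Psi> A))) A"
    by (simp add: multilinear V.scale_right_distrib V.scale_right_diff_distrib
        V.scale_left_diff_distrib right_diff_distrib algebra_simps)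
  then show ?thesis by blast
qed

lemma orbit_direct_sum_line:
  assumes "\<omega> A (\<Psi> A) \<noteq> 0"
  shows "is_direct_sum sV (orbit A) (V.span {A})"
  unfolding is_direct_sum_def
proof (intro conjI allI)
  show "V.subspace (orbit A)" by (rule subspace_orbit)
  show "V.subspace (V.span {A})" by simp
  show "orbit A \<inter> V.span {A} = {0}"
  proof
    show "orbit A \<inter> V.span {A} \<subseteq> {0}"
    proof
      fix v assume v: "v \<in> orbit A \<inter> V.span {A}"
      then obtain m where m: "v = act m A" by blast
      obtain c where c: "v = sV c A"
        using v by (auto simp: V.span_singleton)
      have "\<omega> (sV c A) (\<Psi> A) = 0"
        using form_orbit_Psi m c by metis
      then have "c * \<omega> A (\<Psi> A) = 0"
        by (simp only: bilinear_rules)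
      then show "v \<in> {0}" using assms c by simp
    qed
    show "{0} \<subseteq> orbit A \<inter> V.span {A}"
      using V.subspace_0[OF subspace_orbit] V.span_zero by auto
  qed
  show "\<exists>u\<in>orbit A. \<exists>w\<in>V.span {A}. v = u + w" for v
    using in_orbit_plus_line[OF assms, of v] by (auto simp: V.span_singleton)
qed

lemma form_Psi_nonzero_if_direct_sum:
  assumes nz: "(UNIV :: 'v set) \<noteq> {0}"
    and ds: "is_direct_sum sV (orbit A) (V.span {A})"
  shows "\<omega> A (\<Psi> A) \<noteq> 0"
proof
  assume 0: "\<omega> A (\<Psi> A) = 0"
  have cover: "\<exists>m c. v = act m A + sV c A" for v
    using ds unfolding is_direct_sum_def V.span_singleton by (metis orbitE rangeE)
  have A: "A \<noteq> 0"
  proof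
    assume "A = 0"
    then have "v = 0" for v :: 'v
      using cover[of v] by (auto simp: multilinear)
    then show False using nz by auto
  qed
  have "\<omega> v (\<Psi> A) = 0" for v
    using cover[of v] 0 by (auto simp: multilinear form_orbit_Psi)
  then have Psi: "\<Psi> A = 0" by (rule eq_0_if_orthogonal)
  have orth: "\<omega> A (act m A) = 0" for m
  proof -
    \<comment> \<open>Expanding \<open>m \<Psi>(A) = 0\<close> yields three equal orbit vectors and a multiple of \<open>A\<close>.\<close>
    define n where "n = B\<^sub>\<mu> A (act m A)"
    let ?c = "3 / 2 * \<omega> A (act m A)"
    have "act n A + sV ?c A + act n A + act n A = 0"
      using act_Psi[of m A] by (simp add: Psi mu_act multilinear n_def)
    then have "sV ?c A = act (- (n + n + n)) A"
      by (simp add: multilinear algebra_simps eq_neg_iff_add_eq_0)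
    then have "sV ?c A \<in> orbit A \<inter> V.span {A}"
      unfolding V.span_singleton by (metis IntI orbitI rangeI)
    then have "sV ?c A = 0"
      using ds unfolding is_direct_sum_def by blast
    then show ?thesis using A two three by simp
  qed
  have "\<omega> A v = 0" for v
    using cover[of v] orth by (auto simp: multilinear form_alternating)
  then show False using A form_nondegenerate by blast
qed

lemma Bmu_eq_0_iff_span_Psi:
  assumes "\<omega> A (\<Psi> A) \<noteq> 0"
  shows "B\<^sub>\<mu> A C = 0 \<longleftrightarrow> C \<in> V.span {\<Psi> A}"
proof
  assume B: "B\<^sub>\<mu> A C = 0"
  have mu: "\<mu> A \<noteq> 0"
    using assms by (auto simp: Psi_def multilinear)
  let ?r = "2 / \<omega> A (\<Psi> A)"
  have "C = sV ?r (sV (\<omega> A (\<Psi> A) / 2) C)"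
    using assms two by simp
  also have "\<dots> = sV (- ?r * \<omega> C (\<Psi> A)) A + sV (?r * \<omega> A C / 2) (\<Psi> A)" (is "_ = sV ?x A + sV ?y _")
    by (simp add: scale_by_form_Psi B multilinear V.scale_right_distrib V.scale_right_diff_distrib)
  finally have C: "C = sV ?x A + sV ?y (\<Psi> A)" .
  have "B\<^sub>\<mu> A C = sM ?x (\<mu> A)"
    by (subst C) (simp only: bilinear_rules Bmu_Psi mu_def M.scale_zero_right add_0_right)
  then have "?x = 0" using B mu by (metis M.scale_eq_0_iff)
  then have "C = sV ?y (\<Psi> A)" using C by (metis V.scale_zero_left add_0_left)
  then show "C \<in> V.span {\<Psi> A}"
    unfolding V.span_singleton by blast
next
  assume "C \<in> V.span {\<Psi> A}"
  then show "B\<^sub>\<mu> A C = 0" by (auto simp: V.span_singleton multilinear Bmu_Psi)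
qed

lemma kernel_dmu:
  assumes "\<omega> A (\<Psi> A) \<noteq> 0"
  shows "kernel (dmu sM B\<^sub>\<mu> A) = V.span {\<Psi> A}"
  using Bmu_eq_0_iff_span_Psi[OF assms] two by (auto simp: kernel_def dmu_def)

text \<open>
  The form \<open>\<omega>(a, B(b, c) d)\<close> depends only on the splitting of the four arguments into
  the pairs \<open>{a, d}\<close> and \<open>{b, c}\<close>, by \<open>Bmu_pair_symmetric\<close>. Hence the sum over the three splittings is
  already fully symmetric, and the factor 1/2 turns its diagonal value
  \<open>3 \<omega>(a, \<Psi>(a))\<close> into \<open>Q\<close>.
\<close>

lemma polar_form_Q:
  "quartic_polar_form sV (Q act \<omega> B\<^sub>\<mu>) = (\<lambda>a b c d.
    (\<omega> a (act (B\<^sub>\<mu> b c) d) + \<omega> a (act (B\<^sub>\<mu> b d) c) + \<omega> a (act (B\<^sub>\<mu> c d) b)) / 2)"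
  (is "_ = ?F")
proof (rule quartic_polar_form_eqI[OF two three])
  have pair: "\<omega> a (act (B\<^sub>\<mu> b c) d) = \<omega> b (act (B\<^sub>\<mu> a d) c)" for a b c d
    using Bmu_pair_symmetric[of b c d a] Bmu_symmetric[of d a] act_form[of "B\<^sub>\<mu> d a" b c]
      form_skew[of a "act (B\<^sub>\<mu> b c) d"]
    by simp
  have flip: "\<omega> a (act m d) = \<omega> d (act m a)" for a m d
    using act_form[of m d a] form_skew[of a "act m d"] by simp
  have vector_space_mult: "vector_space ((*) :: 'k \<Rightarrow> 'k \<Rightarrow> 'k)"
    by unfold_locales (simp_all add: algebra_simps)
  show "symmetric_quadrilinear sV ?F"
    unfolding symmetric_quadrilinear_def Vector_Spaces.linear_iff
  proof (intro conjI allI)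
    fix a b c d
    show "?F a b c d = ?F b a c d"
      using pair[of a b c d] pair[of a b d c] flip[of a "B\<^sub>\<mu> c d" b]
      by (simp add: add.commute)
    show "?F a b c d = ?F a c b d" "?F a b c d = ?F a b d c"
      by (simp_all add: Bmu_symmetric[of c b] Bmu_symmetric[of d c] ac_simps)
  qed (rule V.vector_space_axioms vector_space_mult |
      simp add: multilinear add_divide_distrib distrib_left ac_simps)+
  show "?F a a a a = Q act \<omega> B\<^sub>\<mu> a" for a
    by (simp add: Q_def Psi_def mu_def)
qed

lemma dQ_eq: "dQ sV act \<omega> B\<^sub>\<mu> A C = 6 * \<omega> C (\<Psi> A)"
  using two by (simp add: dQ_def polar_form_Q Psi_def mu_def field_simps)

lemma kernel_dQ:
  assumes "\<omega> A (\<Psi> A) \<noteq> 0"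
  shows "kernel (dQ sV act \<omega> B\<^sub>\<mu> A) = orbit A"
proof -
  have "(6::'k) = 2 * 3" by simp
  then have 6: "(6::'k) \<noteq> 0" using two three by (metis mult_eq_0_iff)
  have "C \<in> orbit A" if "\<omega> C (\<Psi> A) = 0" for C
    using in_orbit_plus_line[OF assms, of C] that assms by (auto simp: multilinear form_orbit_Psi)
  then show ?thesis
    using 6 by (auto simp: kernel_def dQ_eq form_orbit_Psi)
qed

section \<open>The Lagrangian criterion\<close>

text \<open>
  If \<open>\<mu>(A) = 0\<close>, equivariance gives \<open>B(A, n A) = 0\<close>. Applying \<open>m\<close> to this gives
  \<open>B(m A, n A) + B(A, m n A) = 0\<close>, and both summands send \<open>A\<close> to multiples of
  \<open>\<omega>(n A, m A) A\<close> whose coefficients \<open>-1/2\<close> and \<open>-3/2\<close> do not cancel.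
\<close>

lemma orbit_isotropic_if_mu_eq_0:
  assumes A: "A \<noteq> 0" and mu: "\<mu> A = 0"
  shows "\<omega> (act n A) (act m A) = 0"
proof -
  have bracket_0: "bracket k 0 = 0" for k
    using Bmu_equivariant[of k 0 0] by (simp add: zero_rules)
  have Bact: "act (B\<^sub>\<mu> A C) A = sV (- (3 / 2 * \<omega> A C)) A" for C
  proof -
    have "act (B\<^sub>\<mu> A C) A + sV (3 / 2 * \<omega> A C) A = 0"
      using mu_act[of A C] by (simp only: mu zero_rules)
    then show ?thesis
      by (simp only: V.scale_minus_left eq_neg_iff_add_eq_0)
  qed
  have B0: "B\<^sub>\<mu> A (act k A) = 0" for k
  proof (rule double_eq_0)
    show "B\<^sub>\<mu> A (act k A) + B\<^sub>\<mu> A (act k A) = 0"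
      using bracket_mu[of k A] by (simp only: mu bracket_0)
  qed
  have A0: "\<omega> A (act k A) = 0" for k
  proof -
    have "sV (- (3 / 2 * \<omega> A (act k A))) A = 0"
      using Bact[of "act k A"] by (simp only: B0 zero_rules)
    then show ?thesis
      using A two three by simp
  qed
  have A0': "\<omega> (act k A) A = 0" for k
    using A0 by (simp add: form_skew[of "act k A" A])
  let ?t = "\<omega> (act n A) (act m A)"
  have "B\<^sub>\<mu> (act m A) (act n A) + B\<^sub>\<mu> A (act m (act n A)) = 0"
    using Bmu_equivariant[of m A "act n A"] by (simp only: B0 bracket_0)
  then have "act (B\<^sub>\<mu> (act m A) (act n A)) A + act (B\<^sub>\<mu> A (act m (act n A))) A = 0"
    by (metis bilinear_rules(1) zero_rules(1))
  moreover have "act (B\<^sub>\<mu> (act m A) (act n A)) A = sV (- (?t / 2)) A"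
  proof -
    have "act (B\<^sub>\<mu> (act n A) (act m A)) A = - sV (?t / 2) A"
      unfolding Bmu_act_swap[of "act n A" "act m A" A]
      by (simp add: Bmu_symmetric[of "act n A" A] B0 A0' zero_rules)
    then show ?thesis
      by (simp add: Bmu_symmetric[of "act m A" "act n A"])
  qed
  moreover have "\<omega> A (act m (act n A)) = ?t"
    using act_form[of m A "act n A"] form_skew[of "act m A" "act n A"] by simp
  ultimately have "sV (- (?t / 2) + - (3 / 2 * ?t)) A = 0"
    by (simp only: Bact V.scale_left_distrib)
  moreover have "- (?t / 2) + - (3 / 2 * ?t) = - (2 * ?t)"
    using two by (simp add: field_simps)
  ultimately have "sV (- (2 * ?t)) A = 0" by (simp only:)
  then show ?thesis
    using A two by (metis V.scale_eq_0_iff mult_eq_0_iff neg_equal_0_iff_equal)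
qed

text \<open>
  For the inclusion of the orthogonal space, fix \<open>Y\<close> with \<open>\<omega>(A, Y) = 1\<close>. A vector \<open>C\<close> orthogonal
  to \<open>\<mm> A\<close> has \<open>B(A, C) = 0\<close> by pair symmetry and \<open>\<omega>(A, C) = 0\<close> because \<open>A\<close> lies in the orbit
  space; exchanging arguments in \<open>B(Y, C) A\<close> twice then leaves \<open>-C\<close> plus a multiple of \<open>A\<close>.
\<close>

lemma lagrangian_if_mu_eq_0:
  assumes A: "A \<noteq> 0" and mu: "\<mu> A = 0"
  shows "lagrangian sV \<omega> (orbit A)"
  unfolding lagrangian_def
proof (intro conjI)
  obtain X where "\<omega> A X \<noteq> 0" using A form_nondegenerate by blast
  define Y where "Y = sV (inverse (\<omega> A X)) X"
  have Y: "\<omega> A Y = 1" using \<open>\<omega> A X \<noteq> 0\<close> by (simp add: Y_def multilinear)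
  have "act (B\<^sub>\<mu> A Y) A + sV (3 / 2) A = 0"
    using mu_act[of A Y] by (simp add: mu multilinear Y)
  then have "sV (3 / 2) A = act (- B\<^sub>\<mu> A Y) A"
    by (simp add: multilinear eq_neg_iff_add_eq_0 add.commute)
  then have "sV (inverse (3 / 2)) (sV (3 / 2) A) \<in> orbit A"
    by (simp only: V.subspace_scale[OF subspace_orbit orbitI])
  moreover have "(3 / 2 :: 'k) \<noteq> 0"
    using two three by simp
  ultimately have A_orbit: "A \<in> orbit A"
    by (metis V.scale_scale V.scale_one left_inverse)
  show "orbit A = orthogonal_space \<omega> (orbit A)"
  proof
    show "orbit A \<subseteq> orthogonal_space \<omega> (orbit A)"
      using orbit_isotropic_if_mu_eq_0[OF A mu]
      by (auto simp: orthogonal_space_def elim!: orbitE)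
    show "orthogonal_space \<omega> (orbit A) \<subseteq> orbit A"
    proof
      fix C assume "C \<in> orthogonal_space \<omega> (orbit A)"
      then have C: "\<omega> v C = 0" if "v \<in> orbit A" for v
        using that by (auto simp: orthogonal_space_def)
      have "\<omega> (act (B\<^sub>\<mu> A C) v) w = 0" for v w
        using Bmu_pair_symmetric[of A C v w] C by auto
      then have AC: "act (B\<^sub>\<mu> A C) v = 0" for v
        using form_nondegenerate by blast
      have 1: "act (B\<^sub>\<mu> Y C) A = act (B\<^sub>\<mu> A Y) C - sV (1 / 2) C - sV (\<omega> Y C / 2) A"
        using Bmu_act_swap[of Y C A] Bmu_symmetric[of Y A] C[OF A_orbit] form_skew[of C A]
          form_skew[of Y A] Y form_skew[of C Y]
        by (simp add: multilinear algebra_simps)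
      have 2: "act (B\<^sub>\<mu> A Y) C = sV (\<omega> Y C) A - sV (1 / 2) C"
        using Bmu_act_swap[of A Y C] by (simp add: AC Y C[OF A_orbit])
      have "sV (1/2) C + sV (1/2) C = C"
        using two V.scale_left_distrib[of "1/2" "1/2" C] by (simp add: field_simps)
      then have "C = sV (\<omega> Y C) A - sV (\<omega> Y C / 2) A - act (B\<^sub>\<mu> Y C) A"
        using 1 2 by (simp add: algebra_simps)
      moreover have "\<dots> \<in> orbit A"
        by (intro V.subspace_diff V.subspace_scale subspace_orbit A_orbit orbitI)
      ultimately show "C \<in> orbit A" by simp
    qed
  qed
qed (rule subspace_orbit)

text \<open>
  Pair symmetry and faithfulness turn isotropy of \<open>\<mm> A\<close> into \<open>B(A, m A) = 0\<close> for all \<open>m\<close>, so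
  \<open>\<mu>(A) = B(A, A)\<close> vanishes once \<open>A\<close> is in the orbit space, that is, orthogonal to it.
\<close>

lemma mu_eq_0_if_lagrangian:
  assumes lag: "lagrangian sV \<omega> (orbit A)" and dim: "dim_gt sV 2"
  shows "\<mu> A = 0"
proof -
  have perp: "v \<in> orbit A \<longleftrightarrow> (\<forall>m. \<omega> (act m A) v = 0)" for v
    using lag unfolding lagrangian_def orthogonal_space_def orbit_space_def by blast
  have B0: "B\<^sub>\<mu> A (act m A) = 0" for m
  proof (rule eq_0_if_acts_trivially)
    fix v
    have "\<omega> (act (B\<^sub>\<mu> A (act m A)) v) w = 0" for w
      using perp[of "act m A"] by (simp add: Bmu_pair_symmetric[of A] orbitI)
    then show "act (B\<^sub>\<mu> A (act m A)) v = 0" by (rule form_nondegenerate)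
  qed
  have Q0: "\<omega> A (\<Psi> A) = 0"
  proof (rule ccontr)
    assume Q: "\<omega> A (\<Psi> A) \<noteq> 0"
    \<comment> \<open>The orbit space is killed by \<open>B(A, \<cdot>)\<close>, so it lies in the line of \<open>\<Psi>(A)\<close>.\<close>
    have "v \<in> V.span {A, \<Psi> A}" for v
    proof -
      obtain m c where v: "v = act m A + sV c A" using in_orbit_plus_line[OF Q] by blast
      have "act m A \<in> V.span {\<Psi> A}" using B0 Bmu_eq_0_iff_span_Psi[OF Q] by blast
      then have "act m A \<in> V.span {A, \<Psi> A}"
        using V.span_mono[of "{\<Psi> A}" "{A, \<Psi> A}"] by blast
      then show ?thesis
        unfolding v by (intro V.span_add V.span_scale) (auto intro: V.span_base)
    qed
    moreover obtain b where b: "V.independent b" "finite b \<longrightarrow> 2 < card b"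
      using dim unfolding dim_gt_def by blast
    ultimately have "finite b \<and> card b \<le> card {A, \<Psi> A}"
      by (intro V.independent_span_bound) auto
    then show False using b card_insert_le_m1[of 2 "{\<Psi> A}" A] by auto
  qed
  have "\<omega> A (act m A) = 0" for m
  proof (cases "\<Psi> A = 0")
    case True
    have "sV (3 / 2 * \<omega> A (act m A)) A = 0"
      using act_Psi[of m A] by (simp add: True B0 mu_act multilinear)
    then show ?thesis using two three by (auto simp: multilinear)
  next
    case False
    then show ?thesis
      using scale_by_form_Psi[of A "act m A"] two by (simp add: Q0 B0 form_orbit_Psi multilinear)
  qed
  then have "A \<in> orbit A" using perp[of A] by (simp add: form_skew[of "act _ A"])
  then show ?thesis using B0 by (metis mu_def orbitE)
qed

end

theorem proposition3p4:
  fixes sM :: "'k::field \<Rightarrow> 'm::ab_group_add \<Rightarrow> 'm"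
    and bracket :: "'m \<Rightarrow> 'm \<Rightarrow> 'm"
    and sV :: "'k \<Rightarrow> 'v::ab_group_add \<Rightarrow> 'v"
    and act :: "'m \<Rightarrow> 'v \<Rightarrow> 'v"
    and \<omega> :: "'v \<Rightarrow> 'v \<Rightarrow> 'k"
    and B\<^sub>\<mu> :: "'v \<Rightarrow> 'v \<Rightarrow> 'm"
    and A :: 'v
  assumes char: "CHAR('k) \<noteq> 2" "CHAR('k) \<noteq> 3"
    and ssr: "special_symplectic_representation sM bracket sV act \<omega> B\<^sub>\<mu>"
    and nonzero: "(UNIV :: 'v set) \<noteq> {0}"
  shows "(Q act \<omega> B\<^sub>\<mu> A \<noteq> 0 \<longleftrightarrow>
            is_direct_sum sV (orbit_space act A) (module.span sV {A})) \<and>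
         (Q act \<omega> B\<^sub>\<mu> A \<noteq> 0 \<longrightarrow>
            kernel (dmu sM B\<^sub>\<mu> A) = module.span sV {Psi act B\<^sub>\<mu> A} \<and>
            kernel (dQ sV act \<omega> B\<^sub>\<mu> A) = orbit_space act A) \<and>
         (dim_gt sV 2 \<and> A \<noteq> 0 \<longrightarrow>
            (lagrangian sV \<omega> (orbit_space act A) \<longleftrightarrow> mu B\<^sub>\<mu> A = 0))"
proof -
  interpret special_symplectic_representation_23 sM bracket sV act \<omega> B\<^sub>\<mu>
    using ssr two_three_nonzero[OF char]
    by (simp add: special_symplectic_representation_23_def
        special_symplectic_representation_23_axioms_def)
  show ?thesis
    using orbit_direct_sum_line form_Psi_nonzero_if_direct_sum[OF nonzero] kernel_dmu kernel_dQ
      lagrangian_if_mu_eq_0 mu_eq_0_if_lagrangian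
    unfolding Q_nonzero_iff by blast
qed

end
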